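(* Let $A:\mathbb{R}^n\to\mathbb{R}^{n\times n}$ and $B:\mathbb{R}^n\to\mathbb{R}^{n\times m}$ be continuous and let $\bar\gamma>0$ be given. Consider closed-loop trajectories $$x_{t+1}=(A(x_t)+B(x_t)K(x_t))\,x_t,\qquad K(x_t):=Y(x_t)P(x_t)^{-1},\qquad t\in\mathbb{N}_0,$$ where, for each $t\ge0$, $(Y(x_t),P(x_t),L(x_t),\gamma(x_t))$ is any optimal solution of the program $\mathrm{SDP}_t$ (defined in the context) at $x_t$, which for $t\ge1$ is built with the matrix $P(x_{t-1})$ chosen at the previous step. Assume that $\mathrm{SDP}_t$, with the given $\bar\gamma$, is feasible for every $t\ge0$ along these trajectories. Then the origin of the closed-loop system is asymptotically stable: for every $\varepsilon>0$ there is $\delta>0$ such that every such trajectory with $|x_0|<\delta$ satisfies $|x_t|<\varepsilon$ for all $t\ge0$, and every such trajectory satisfies $x_t\to0$ as $t\to\infty$. Furthermore, if the matrix $P(x_t)-I$ is nonsingular for all $t\ge0$, then the origin is geometrically stable, namely $$|x_t|\le\sqrt{\bar\gamma}\,\sqrt{(1-\bar\gamma^{-1})^t}\;|x_0|\qquad\text{for all } t\ge0.$$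
   Context: $|\cdot|$ is the Euclidean norm; $\mathbb{S}^{n\times n}$ is the set of real symmetric $n\times n$ matrices; $\succ,\succeq$ denote positive (semi)definiteness of symmetric matrices. The open-loop system is $x_{t+1}=A(x_t)x_t+B(x_t)u_t$ with control $u_t=K(x_t)x_t$. For $t\ge 1$, given $x_t\in\mathbb{R}^n$ and $P(x_{t-1})\succ0$, the program $\mathrm{SDP}_t$ has decision variables $Y\in\mathbb{R}^{m\times n}$, $P\in\mathbb{S}^{n\times n}$, $L\in\mathbb{S}^{m\times m}$, $\gamma\in\mathbb{R}$ (optimal values are denoted $Y(x_t),P(x_t),L(x_t),\gamma(x_t)$): minimize $\gamma$ subject to 1. $\begin{bmatrix}P-I & A(x_t)P+B(x_t)Y \\ (A(x_t)P+B(x_t)Y)^\top & P\end{bmatrix}\succeq0$, 2. $\begin{bmatrix} L & Y \\ {Y}^\top & P \end{bmatrix}\succeq0$, 3. $\gamma\ge\operatorname{tr}P+\operatorname{tr}L$, 4. $\begin{bmatrix}x_t^\top P(x_{t-1})^{-1}x_t & x_t^\top \\ x_t & P\end{bmatrix}\succeq0$, 5. $\gamma\le\bar\gamma$. For $t=0$, the program $\mathrm{SDP}_0$ at $x_0$ is the same problem with constraints 4 and 5 omitted. Constraint 1 forces $P\succeq I$, so $P$ is invertible. *)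

theory Defs
  imports "HOL-Analysis.Analysis"
begin

definition psd :: "real^'k^'k \<Rightarrow> bool" where
  "psd M \<longleftrightarrow> transpose M = M \<and> (\<forall>v. 0 \<le> v \<bullet> (M *v v))"

(* The 2x2 block matrix [[M11, M12], [M21, M22]]; Inl indexes the first block of
   rows or columns, Inr the second.  The types force the block sizes to match. *)
definition block_matrix ::
  "real^'c^'r \<Rightarrow> real^'d^'r \<Rightarrow> real^'c^'s \<Rightarrow> real^'d^'s \<Rightarrow> real^('c + 'd)^('r + 's)" where
  "block_matrix M11 M12 M21 M22 =
     (\<chi> i j. case i of
        Inl a \<Rightarrow> (case j of Inl c \<Rightarrow> M11 $ a $ c | Inr d \<Rightarrow> M12 $ a $ d)
      | Inr b \<Rightarrow> (case j of Inl c \<Rightarrow> M21 $ b $ c | Inr d \<Rightarrow> M22 $ b $ d))"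

(* Decision variables (Y, P, L, gamma); real^'n^'m is the type of m-by-n matrices. *)
type_synonym ('n, 'm) sdp_vars = "(real^'n^'m) \<times> (real^'n^'n) \<times> (real^'m^'m) \<times> real"

definition sdp_init ::
  "(real^'n \<Rightarrow> real^'n^'n) \<Rightarrow> (real^'n \<Rightarrow> real^'m^'n) \<Rightarrow> real^'n \<Rightarrow> ('n, 'm) sdp_vars set" where
  "sdp_init A B x = {(Y, P, L, \<gamma>).
     transpose P = P \<and> transpose L = L \<and>
     psd (block_matrix (P - mat 1) (A x ** P + B x ** Y)
            (transpose (A x ** P + B x ** Y)) P) \<and>
     psd (block_matrix L Y (transpose Y) P) \<and>
     \<gamma> \<ge> trace P + trace L}"

(* Q is the matrix P chosen at the previous step.  For a scalar s, the term
   (mat s :: real^1^1) is the 1-by-1 matrix with entry s. *)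
definition sdp_step ::
  "(real^'n \<Rightarrow> real^'n^'n) \<Rightarrow> (real^'n \<Rightarrow> real^'m^'n) \<Rightarrow> real \<Rightarrow> real^'n^'n \<Rightarrow> real^'n \<Rightarrow>
   ('n, 'm) sdp_vars set" where
  "sdp_step A B \<gamma>bar Q x = {(Y, P, L, \<gamma>).
     (Y, P, L, \<gamma>) \<in> sdp_init A B x \<and>
     psd (block_matrix (mat (x \<bullet> (matrix_inv Q *v x)) :: real^1^1) (rowvector x)
            (columnvector x) P) \<and>
     \<gamma> \<le> \<gamma>bar}"

(* Feasible set of the program solved at time t along the states x with chosen matrices P. *)
definition sdp_at ::
  "(real^'n \<Rightarrow> real^'n^'n) \<Rightarrow> (real^'n \<Rightarrow> real^'m^'n) \<Rightarrow> real \<Rightarrow>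
   (nat \<Rightarrow> real^'n) \<Rightarrow> (nat \<Rightarrow> real^'n^'n) \<Rightarrow> nat \<Rightarrow> ('n, 'm) sdp_vars set" where
  "sdp_at A B \<gamma>bar x P t =
     (case t of 0 \<Rightarrow> sdp_init A B (x 0) | Suc s \<Rightarrow> sdp_step A B \<gamma>bar (P s) (x (Suc s)))"

definition sdp_optimal :: "('n, 'm) sdp_vars set \<Rightarrow> ('n, 'm) sdp_vars \<Rightarrow> bool" where
  "sdp_optimal S z \<longleftrightarrow> is_arg_min (\<lambda>(Y, P, L, \<gamma>). \<gamma>) (\<lambda>w. w \<in> S) z"

(* Optimal solutions need not be unique, so Y, P, L, gamma are sequences of choices
   indexed by time rather than functions of the state. *)
definition closed_loop_trajectory ::
  "(real^'n \<Rightarrow> real^'n^'n) \<Rightarrow> (real^'n \<Rightarrow> real^'m^'n) \<Rightarrow> real \<Rightarrow>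
   (nat \<Rightarrow> real^'n) \<Rightarrow> (nat \<Rightarrow> real^'n^'m) \<Rightarrow> (nat \<Rightarrow> real^'n^'n) \<Rightarrow> (nat \<Rightarrow> real^'m^'m) \<Rightarrow>
   (nat \<Rightarrow> real) \<Rightarrow> bool" where
  "closed_loop_trajectory A B \<gamma>bar x Y P L \<gamma> \<longleftrightarrow>
     (\<forall>t. sdp_optimal (sdp_at A B \<gamma>bar x P t) (Y t, P t, L t, \<gamma> t) \<and>
          x (Suc t) = (A (x t) + B (x t) ** (Y t ** matrix_inv (P t))) *v x t)"

end

theory Submission
  imports Defs
begin

text \<open>
  The Lyapunov function is the value \<open>V t = x t \<bullet> (matrix_inv (P t) *v x t)\<close>, and
  the core of the proof is the contraction \<open>V (t + 1) \<le> (1 - 1/g) * V t\<close>, where \<open>g\<close>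
  is the given bound on the optimal values. The first constraint says that the
  closed-loop matrix \<open>M\<close> satisfies \<open>M P M\<^sup>T \<le> P - I\<close> in the semidefinite order. Instead of
  inverting \<open>P - I\<close>, which may be singular, one tests the block matrix on the plane spanned by
  \<open>(w, 0)\<close> and \<open>(0, matrix_inv P *v x)\<close>, where \<open>y = M x\<close> is the successor of \<open>x\<close> and
  \<open>w = matrix_inv P *v y\<close>. The discriminant of the resulting binary form gives, with
  \<open>W = y \<bullet> w\<close>,

    \<open>W\<^sup>2 \<le> (W - w \<bullet> w) * V\<close>.

  A contraction follows once \<open>w \<bullet> w \<ge> W / g\<close>. A bound \<open>P \<le> g I\<close> would give this, but the
  initial program does not bound its optimal value, so that in the first step such a bound
  is available only for the next matrix \<open>P'\<close>. This suffices: the next program keeps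
  \<open>y \<bullet> (matrix_inv P' *v y) \<le> W\<close> through the constraint that
  refers to \<open>P\<close>, and \<open>P' \<le> g I\<close>
  (the second constraint forces \<open>L \<ge> 0\<close>, so \<open>tr P' \<le> g\<close>), hence \<open>y \<bullet> y \<le> g * W\<close>, and Cauchy-Schwarz for
  \<open>W = y \<bullet> w\<close> yields \<open>W / g \<le> w \<bullet> w\<close>. The argument is
  \<open>inverse_form_decrease\<close>.

  Since \<open>P \<ge> I\<close> gives \<open>V 0 \<le> |x 0|\<^sup>2\<close>, and \<open>P t \<le> g I\<close> gives \<open>|x t|\<^sup>2 \<le> g * V t\<close> for
  \<open>t \<ge> 1\<close>, every trajectory obeys the geometric bound
  \<open>closed_loop_geometric_bound\<close>. Stability and convergence are read off from it.
\<close>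

section \<open>Positive semidefinite matrices\<close>

lemma discriminant_bound:
  fixes p q r :: real
  assumes form: "\<And>a b. 0 \<le> a\<^sup>2 * p + 2 * (a * b) * q + b\<^sup>2 * r"
  shows "q\<^sup>2 \<le> p * r"
proof -
  have p: "0 \<le> p" and r: "0 \<le> r" using form[of 1 0] form[of 0 1] by simp_all
  \<comment> \<open>Both test points are minimisers for one fixed coordinate, with denominators cleared; each
    settles the case in which its own factor is positive.\<close>
  have "0 \<le> r * (p * r - q\<^sup>2)"
    using form[of r "-q"] by (simp add: algebra_simps power2_eq_square)
  moreover have "0 \<le> p * (p * r - q\<^sup>2)"
    using form[of "-q" p] by (simp add: algebra_simps power2_eq_square)
  moreover have "q = 0" if "p = 0" "r = 0"
    using form[of 1 1] form[of 1 "-1"] that by simp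
  ultimately show ?thesis using p r
    by (cases "p = 0"; cases "r = 0") (auto simp: zero_le_mult_iff mult_le_0_iff)
qed

lemma symmetric_entries: "transpose M = M \<Longrightarrow> M $ i $ j = M $ j $ i"
  by (simp add: transpose_def vec_eq_iff)

lemma inner_matrix_symmetric:
  fixes M :: "real^'k^'k"
  assumes "transpose M = M"
  shows "u \<bullet> (M *v v) = v \<bullet> (M *v u)"
  by (metis assms dot_lmul_matrix inner_commute transpose_matrix_vector)

lemma psd_Cauchy_Schwarz:
  fixes M :: "real^'k^'k"
  assumes "psd M"
  shows "(u \<bullet> (M *v v))\<^sup>2 \<le> (u \<bullet> (M *v u)) * (v \<bullet> (M *v v))"
proof (rule discriminant_bound)
  fix a b :: real
  have sym: "v \<bullet> (M *v u) = u \<bullet> (M *v v)"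
    using assms inner_matrix_symmetric unfolding psd_def by blast
  have "0 \<le> (a *\<^sub>R u + b *\<^sub>R v) \<bullet> (M *v (a *\<^sub>R u + b *\<^sub>R v))"
    using assms by (simp add: psd_def)
  then show "0 \<le> a\<^sup>2 * (u \<bullet> (M *v u)) + 2 * (a * b) * (u \<bullet> (M *v v)) + b\<^sup>2 * (v \<bullet> (M *v v))"
    by (simp add: matrix_vector_right_distrib matrix_vector_mult_scaleR inner_add_left
        inner_add_right sym power2_eq_square algebra_simps)
qed

lemma inner_axis_matrix_axis:
  fixes M :: "real^'k^'k"
  shows "axis i 1 \<bullet> (M *v axis i 1) = M $ i $ i"
  by (simp add: inner_axis' matrix_vector_mult_basis column_def)

lemma psd_diagonal_nonneg: "psd M \<Longrightarrow> 0 \<le> M $ i $ i"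
  unfolding psd_def inner_axis_matrix_axis[symmetric] by blast

lemma psd_trace_nonneg: "psd M \<Longrightarrow> 0 \<le> trace M"
  by (simp add: trace_def sum_nonneg psd_diagonal_nonneg)

text \<open>
  This is \<open>M\<^sup>2 \<le> tr M * M\<close>, a form of the bound of a positive semidefinite matrix by its
  trace. It follows from Cauchy-Schwarz for the form of \<open>M\<close> against each coordinate vector,
  without eigenvalues. For invertible \<open>M\<close> and
  \<open>v = matrix_inv M *v x\<close> it compares \<open>|x|\<^sup>2\<close> with the
  form of the inverse.
\<close>
lemma psd_norm_image_le_trace:
  fixes M :: "real^'k^'k"
  assumes "psd M"
  shows "(norm (M *v v))\<^sup>2 \<le> trace M * (v \<bullet> (M *v v))"
proof -
  have "(norm (M *v v))\<^sup>2 = (\<Sum>i\<in>UNIV. (axis i 1 \<bullet> (M *v v))\<^sup>2)"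
    by (simp add: norm_eq_sqrt_inner inner_vec_def[of "M *v v" "M *v v"] inner_axis'
        sum_nonneg flip: power2_eq_square)
  also have "\<dots> \<le> (\<Sum>i\<in>UNIV. M $ i $ i * (v \<bullet> (M *v v)))"
    by (rule sum_mono) (metis psd_Cauchy_Schwarz[OF assms] inner_axis_matrix_axis)
  finally show ?thesis by (simp add: trace_def sum_distrib_right)
qed

text \<open>
  A block constraint is used by testing its quadratic form on the stacked vector \<open>(a, b)\<close>; the two
  off-diagonal terms agree because the whole matrix is symmetric.
\<close>
lemma psd_block_form:
  fixes M11 :: "real^'r^'r" and M22 :: "real^'s^'s"
  assumes "psd (block_matrix M11 M12 M21 M22)"
  shows "0 \<le> a \<bullet> (M11 *v a) + 2 * (a \<bullet> (M12 *v b)) + b \<bullet> (M22 *v b)"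
    and "transpose M11 = M11"
proof -
  let ?M = "block_matrix M11 M12 M21 M22"
  have split_sum: "(\<Sum>k\<in>UNIV. f k) = (\<Sum>i\<in>UNIV. f (Inl i)) + (\<Sum>j\<in>UNIV. f (Inr j))"
    for f :: "'r + 's \<Rightarrow> real"
    unfolding UNIV_Plus_UNIV[symmetric] by (subst sum.Plus) simp_all
  have "transpose ?M = ?M" using assms by (simp add: psd_def)
  then have entries: "?M $ k $ l = ?M $ l $ k" for k l
    by (rule symmetric_entries)
  have off: "M21 = transpose M12"
    using entries[of "Inr _" "Inl _"] by (simp add: vec_eq_iff transpose_def block_matrix_def)
  show "transpose M11 = M11"
    using entries[of "Inl _" "Inl _"] by (simp add: vec_eq_iff transpose_def block_matrix_def)
  define c :: "real^('r + 's)" where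
    "c = (\<chi> k. case k of Inl i \<Rightarrow> a $ i | Inr j \<Rightarrow> b $ j)"
  have "0 \<le> c \<bullet> (?M *v c)" using assms by (simp add: psd_def)
  also have "c \<bullet> (?M *v c)
      = a \<bullet> (M11 *v a) + a \<bullet> (M12 *v b) + (b \<bullet> (M21 *v a) + b \<bullet> (M22 *v b))"
    by (simp add: c_def block_matrix_def inner_vec_def matrix_vector_mult_def split_sum
        distrib_left sum.distrib)
  also have "b \<bullet> (M21 *v a) = a \<bullet> (M12 *v b)"
    unfolding off by (metis dot_lmul_matrix inner_commute transpose_matrix_vector)
  finally show "0 \<le> a \<bullet> (M11 *v a) + 2 * (a \<bullet> (M12 *v b)) + b \<bullet> (M22 *v b)" by simp
qed

lemma psd_block_diagonal_left:
  fixes M11 :: "real^'r^'r" and M22 :: "real^'s^'s"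
  assumes "psd (block_matrix M11 M12 M21 M22)"
  shows "psd M11"
  using psd_block_form[OF assms] psd_block_form(1)[OF assms, of _ 0] by (simp add: psd_def)

section \<open>The inverse form of a matrix that dominates the identity\<close>

lemma psd_minus_identity:
  fixes P :: "real^'n^'n"
  assumes "psd (P - mat 1)"
  shows "v \<bullet> v \<le> v \<bullet> (P *v v)" "psd P"
proof -
  show le: "v \<bullet> v \<le> v \<bullet> (P *v v)" for v
    using assms by (simp add: psd_def matrix_vector_mult_diff_rdistrib inner_diff_right)
  have "transpose (P - mat 1) = P - mat 1" using assms by (simp add: psd_def)
  then have entries: "(P - mat 1) $ j $ i = (P - mat 1) $ i $ j" for i j
    by (rule symmetric_entries)
  have "P $ j $ i = P $ i $ j" for i j
    using entries[of j i] by (cases "i = j") (simp_all add: mat_def)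
  then have "transpose P = P" by (simp add: vec_eq_iff transpose_def)
  then show "psd P" using le order_trans[OF inner_ge_zero] by (auto simp: psd_def)
qed

lemma psd_minus_identity_inverse:
  fixes P :: "real^'n^'n"
  assumes "psd (P - mat 1)"
  shows "matrix_inv P ** P = mat 1" "P *v (matrix_inv P *v x) = x"
proof -
  have "v = 0" if "P *v v = 0" for v
    using psd_minus_identity(1)[OF assms, of v] that
    by (metis inner_gt_zero_iff inner_zero_right not_le)
  then have "\<exists>C. C ** P = mat 1"
    using matrix_left_invertible_ker by blast
  then have "invertible P"
    by (metis invertible_def matrix_left_right_inverse)
  then have "matrix_inv P ** P = mat 1" "P ** matrix_inv P = mat 1"
    unfolding matrix_inv_def invertible_def by (metis (mono_tags, lifting) someI_ex)+
  then show "matrix_inv P ** P = mat 1" "P *v (matrix_inv P *v x) = x"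
    by (simp_all add: matrix_vector_mul_assoc)
qed

text \<open>
  For \<open>w = matrix_inv P *v x\<close> the domination \<open>P \<ge> I\<close> reads \<open>w \<bullet> w \<le> x \<bullet> w\<close>, and
  Cauchy-Schwarz turns this into \<open>x \<bullet> w \<le> x \<bullet> x\<close>.
\<close>
lemma inverse_form_le_norm:
  fixes P :: "real^'n^'n"
  assumes "psd (P - mat 1)"
  shows "0 \<le> x \<bullet> (matrix_inv P *v x)" "x \<bullet> (matrix_inv P *v x) \<le> (norm x)\<^sup>2"
proof -
  define w where "w = matrix_inv P *v x"
  have x: "x = P *v w" by (simp add: w_def psd_minus_identity_inverse[OF assms])
  have ww: "w \<bullet> w \<le> x \<bullet> w"
    using psd_minus_identity(1)[OF assms, of w] by (simp add: x inner_commute)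
  then have nonneg: "0 \<le> x \<bullet> w" using inner_ge_zero order_trans by blast
  then show "0 \<le> x \<bullet> (matrix_inv P *v x)" by (simp add: w_def)
  have "(x \<bullet> w) * (x \<bullet> w) \<le> (x \<bullet> x) * (w \<bullet> w)"
    using Cauchy_Schwarz_ineq[of x w] by (simp add: power2_eq_square)
  also have "\<dots> \<le> (x \<bullet> x) * (x \<bullet> w)" using ww by (simp add: mult_left_mono)
  finally have "x \<bullet> w \<le> x \<bullet> x"
    using nonneg by (cases "x \<bullet> w = 0") auto
  then show "x \<bullet> (matrix_inv P *v x) \<le> (norm x)\<^sup>2"
    by (simp add: w_def power2_norm_eq_inner)
qed

lemma norm_le_trace_inverse_form:
  fixes P :: "real^'n^'n"
  assumes "psd (P - mat 1)"
  shows "(norm x)\<^sup>2 \<le> trace P * (x \<bullet> (matrix_inv P *v x))"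
  using psd_norm_image_le_trace[OF psd_minus_identity(2)[OF assms], of "matrix_inv P *v x"]
  by (simp add: psd_minus_identity_inverse[OF assms] inner_commute)

lemma one_le_trace:
  fixes P :: "real^'n^'n"
  assumes "psd (P - mat 1)"
  shows "1 \<le> trace P"
proof -
  obtain i :: 'n where True by blast
  have "1 \<le> P $ i $ i"
    using psd_diagonal_nonneg[OF assms, of i] by (simp add: mat_def)
  also have "\<dots> \<le> trace P"
    unfolding trace_def using psd_diagonal_nonneg[OF psd_minus_identity(2)[OF assms]]
    by (intro member_le_sum) auto
  finally show ?thesis .
qed

section \<open>Decrease of the Lyapunov function\<close>

text \<open>
  A Schur complement in one direction only: the constraint is tested on
  \<open>(a w, b (matrix_inv P *v x))\<close> for all scalars \<open>a\<close>, \<open>b\<close>. With \<open>N = A P + B Y\<close>,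
  the vector \<open>y\<close> is the closed-loop successor of \<open>x\<close>.
\<close>
lemma lyapunov_lmi:
  fixes P N :: "real^'n^'n"
  assumes lmi: "psd (block_matrix (P - mat 1) N (transpose N) P)"
    and y: "y = N *v (matrix_inv P *v x)"
  defines "w \<equiv> matrix_inv P *v y"
  shows "(y \<bullet> w)\<^sup>2 \<le> (y \<bullet> w - w \<bullet> w) * (x \<bullet> (matrix_inv P *v x))"
proof (rule discriminant_bound)
  fix a b :: real
  have P: "psd (P - mat 1)" using psd_block_diagonal_left[OF lmi] .
  have Pw: "P *v w = y" by (simp add: w_def psd_minus_identity_inverse[OF P])
  let ?z = "matrix_inv P *v x"
  have Pz: "P *v ?z = x" by (simp add: psd_minus_identity_inverse[OF P])
  have "0 \<le> (a *\<^sub>R w) \<bullet> ((P - mat 1) *v (a *\<^sub>R w)) + 2 * ((a *\<^sub>R w) \<bullet> (N *v (b *\<^sub>R ?z)))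
      + (b *\<^sub>R ?z) \<bullet> (P *v (b *\<^sub>R ?z))"
    by (rule psd_block_form(1)[OF lmi])
  moreover have "(P - mat 1) *v (a *\<^sub>R w) = a *\<^sub>R (y - w)"
    by (simp add: matrix_vector_mult_scaleR matrix_vector_mult_diff_rdistrib Pw)
  moreover have "N *v (b *\<^sub>R ?z) = b *\<^sub>R y" "P *v (b *\<^sub>R ?z) = b *\<^sub>R x"
    by (simp_all only: matrix_vector_mult_scaleR y Pz)
  ultimately show "0 \<le> a\<^sup>2 * (y \<bullet> w - w \<bullet> w) + 2 * (a * b) * (y \<bullet> w) + b\<^sup>2 * (x \<bullet> ?z)"
    by (simp add: inner_diff_right inner_commute[of w y] inner_commute[of ?z x]
        power2_eq_square right_diff_distrib mult.assoc mult.left_commute)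
qed

text \<open>
  The constraint that links consecutive programs is tested on \<open>(1, - matrix_inv P *v y)\<close>, the minimiser over the second block;
  the quadratic form there is the Schur complement.
\<close>
lemma sdp_step_inverse_form_le:
  fixes P :: "real^'n^'n"
  assumes lmi: "psd (block_matrix (mat s :: real^1^1) (rowvector y) (columnvector y) P)"
    and P: "psd (P - mat 1)"
  shows "y \<bullet> (matrix_inv P *v y) \<le> s"
proof -
  define w where "w = matrix_inv P *v y"
  have Pw: "P *v w = y" by (simp add: w_def psd_minus_identity_inverse[OF P])
  have "(1 :: real^1) \<bullet> ((mat s :: real^1^1) *v 1) = s"
    by (simp add: inner_vec_def matrix_vector_mult_def mat_def)
  moreover have "(1 :: real^1) \<bullet> (rowvector y *v (- w)) = - (y \<bullet> w)"
    by (simp add: inner_vec_def matrix_vector_mult_def rowvector_def sum_negf)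
  moreover have "(- w) \<bullet> (P *v (- w)) = y \<bullet> w"
    by (simp add: Pw matrix_vector_mult_scaleR[of P "-1" w, simplified] inner_commute)
  ultimately show ?thesis
    using psd_block_form(1)[OF lmi, of 1 "- w"] by (simp add: w_def)
qed

text \<open>
  One step of the Lyapunov decrease. The bound by \<open>g\<close> is imposed on the new matrix \<open>P'\<close> and not on
  \<open>P\<close>, so that the lemma covers the step out of the initial time as well: Cauchy-Schwarz between
  \<open>y\<close> and \<open>w\<close> transfers the bound from \<open>P'\<close> to the direction \<open>w\<close> in which
  \<open>lyapunov_lmi\<close> needs it.
\<close>
lemma inverse_form_decrease:
  fixes P P' N :: "real^'n^'n"
  assumes lmi: "psd (block_matrix (P - mat 1) N (transpose N) P)"
    and y: "y = N *v (matrix_inv P *v x)"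
    and P': "psd (P' - mat 1)"
    and trace: "trace P' \<le> g"
    and mono: "y \<bullet> (matrix_inv P' *v y) \<le> y \<bullet> (matrix_inv P *v y)"
  shows "y \<bullet> (matrix_inv P' *v y) \<le> (1 - inverse g) * (x \<bullet> (matrix_inv P *v x))"
proof -
  define w where "w = matrix_inv P *v y"
  define W where "W = y \<bullet> w"
  define V where "V = x \<bullet> (matrix_inv P *v x)"
  have g: "1 \<le> g" using one_le_trace[OF P'] trace by simp
  have P: "psd (P - mat 1)" using psd_block_diagonal_left[OF lmi] .
  have V: "0 \<le> V" and W: "0 \<le> W"
    using inverse_form_le_norm(1)[OF P] by (simp_all add: V_def W_def w_def)
  have schur: "W\<^sup>2 \<le> (W - w \<bullet> w) * V"
    using lyapunov_lmi[OF lmi y] by (simp add: V_def W_def w_def)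
  have "y \<bullet> y \<le> trace P' * (y \<bullet> (matrix_inv P' *v y))"
    using norm_le_trace_inverse_form[OF P', of y] by (simp add: power2_norm_eq_inner)
  also have "\<dots> \<le> g * W"
    using trace mono g inverse_form_le_norm(1)[OF P'] by (intro mult_mono) (auto simp: W_def w_def)
  finally have yy: "y \<bullet> y \<le> g * W" .
  have "W \<le> (1 - inverse g) * V"
  proof (cases "W = 0")
    case True
    then show ?thesis using V g by (simp add: inverse_le_1_iff)
  next
    case False
    then have pos: "0 < W" using W by simp
    have "W * W \<le> (y \<bullet> y) * (w \<bullet> w)"
      using Cauchy_Schwarz_ineq[of y w] by (simp add: W_def power2_eq_square)
    also have "\<dots> \<le> (g * W) * (w \<bullet> w)" using yy by (simp add: mult_right_mono)
    finally have "W \<le> g * (w \<bullet> w)" using pos by (simp add: mult.assoc mult.left_commute)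
    then have "inverse g * W \<le> w \<bullet> w" using g by (simp add: field_simps)
    then have "(W - w \<bullet> w) * V \<le> (W - inverse g * W) * V"
      using V by (intro mult_right_mono) auto
    then have "W * W \<le> W * ((1 - inverse g) * V)"
      using schur by (simp add: power2_eq_square algebra_simps)
    then show ?thesis using pos by simp
  qed
  then show ?thesis using mono by (simp add: W_def V_def w_def)
qed

section \<open>Closed-loop trajectories\<close>

text \<open>
  What optimality contributes along a trajectory is feasibility of the chosen point at every time. The gain
  \<open>Y (matrix_inv P)\<close> is absorbed by writing \<open>x = P (matrix_inv P *v x)\<close>, which gives the dynamics in
  terms of the matrix \<open>A P + B Y\<close> that enters the constraint.
\<close>
lemma closed_loop_trajectory_step:
  fixes x :: "nat \<Rightarrow> real^'n" and Y :: "nat \<Rightarrow> real^'n^'m"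
  assumes traj: "closed_loop_trajectory A B g x Y P L \<gamma>"
  shows "psd (P t - mat 1)"
    and "psd (block_matrix (P t - mat 1) (A (x t) ** P t + B (x t) ** Y t)
          (transpose (A (x t) ** P t + B (x t) ** Y t)) (P t))"
    and "x (Suc t) = (A (x t) ** P t + B (x t) ** Y t) *v (matrix_inv (P t) *v x t)"
    and "trace (P (Suc t)) \<le> g"
    and "x (Suc t) \<bullet> (matrix_inv (P (Suc t)) *v x (Suc t))
          \<le> x (Suc t) \<bullet> (matrix_inv (P t) *v x (Suc t))"
proof -
  have member: "(Y k, P k, L k, \<gamma> k) \<in> sdp_at A B g x P k" for k
    using traj by (auto simp: closed_loop_trajectory_def sdp_optimal_def is_arg_min_def)
  then have init: "(Y k, P k, L k, \<gamma> k) \<in> sdp_init A B (x k)" for k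
    using member[of k] by (cases k) (simp_all add: sdp_at_def sdp_step_def)
  show lmi: "psd (block_matrix (P t - mat 1) (A (x t) ** P t + B (x t) ** Y t)
          (transpose (A (x t) ** P t + B (x t) ** Y t)) (P t))"
    using init[of t] by (simp add: sdp_init_def)
  have ge: "psd (P k - mat 1)" for k
    using init[of k] psd_block_diagonal_left by (fastforce simp: sdp_init_def)
  then show "psd (P t - mat 1)" .
  have "A (x t) *v x t = (A (x t) ** P t) *v (matrix_inv (P t) *v x t)"
    by (metis matrix_vector_mul_assoc psd_minus_identity_inverse(2)[OF ge])
  moreover have "x (Suc t) = (A (x t) + B (x t) ** (Y t ** matrix_inv (P t))) *v x t"
    using traj by (simp add: closed_loop_trajectory_def)
  ultimately show "x (Suc t) = (A (x t) ** P t + B (x t) ** Y t) *v (matrix_inv (P t) *v x t)"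
    by (simp add: matrix_vector_mult_add_rdistrib del: matrix_vector_mul_assoc
        flip: matrix_vector_mul_assoc)
  have step: "(Y (Suc t), P (Suc t), L (Suc t), \<gamma> (Suc t)) \<in> sdp_step A B g (P t) (x (Suc t))"
    using member[of "Suc t"] by (simp add: sdp_at_def)
  have "0 \<le> trace (L (Suc t))"
    using init[of "Suc t"] by (auto simp: sdp_init_def intro: psd_trace_nonneg psd_block_diagonal_left)
  then show "trace (P (Suc t)) \<le> g"
    using step by (simp add: sdp_step_def sdp_init_def)
  show "x (Suc t) \<bullet> (matrix_inv (P (Suc t)) *v x (Suc t))
          \<le> x (Suc t) \<bullet> (matrix_inv (P t) *v x (Suc t))"
    using step by (intro sdp_step_inverse_form_le[OF _ ge]) (simp add: sdp_step_def)
qed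

text \<open>
  At time 0 the trace of \<open>P 0\<close> is not controlled, so the comparison of \<open>|x t|\<^sup>2\<close> with \<open>g * V t\<close>
  starts at time 1; at time 0 the bound is just \<open>1 \<le> g\<close>.
\<close>
lemma closed_loop_geometric_bound:
  fixes x :: "nat \<Rightarrow> real^'n" and Y :: "nat \<Rightarrow> real^'n^'m"
  assumes traj: "closed_loop_trajectory A B g x Y P L \<gamma>"
  shows "1 \<le> g"
    and "norm (x t) \<le> sqrt g * sqrt ((1 - inverse g) ^ t) * norm (x 0)"
proof -
  note step = closed_loop_trajectory_step[OF traj]
  define V where "V k = x k \<bullet> (matrix_inv (P k) *v x k)" for k
  define r where "r = 1 - inverse g"
  show g: "1 \<le> g" using one_le_trace[OF step(1)] step(4) order_trans by blast
  then have r: "0 \<le> r" by (simp add: r_def inverse_le_1_iff)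
  have decrease: "V (Suc k) \<le> r * V k" for k
    unfolding V_def r_def by (rule inverse_form_decrease[OF step(2,3,1,4,5)])
  have decay: "V k \<le> r ^ k * V 0" for k
  proof (induction k)
    case (Suc k)
    have "V (Suc k) \<le> r * (r ^ k * V 0)"
      using decrease[of k] mult_left_mono[OF Suc r] by linarith
    then show ?case by (simp add: mult.assoc)
  qed simp
  have V0: "V 0 \<le> (norm (x 0))\<^sup>2" unfolding V_def by (rule inverse_form_le_norm(2)[OF step(1)])
  have V_nonneg: "0 \<le> V k" for k unfolding V_def by (rule inverse_form_le_norm(1)[OF step(1)])
  have "(norm (x t))\<^sup>2 \<le> g * r ^ t * (norm (x 0))\<^sup>2"
  proof (cases t)
    case 0
    then show ?thesis using mult_right_mono[OF g, of "(norm (x 0))\<^sup>2"] by simp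
  next
    case (Suc s)
    have "(norm (x t))\<^sup>2 \<le> trace (P t) * V t"
      unfolding V_def by (rule norm_le_trace_inverse_form[OF step(1)])
    also have "\<dots> \<le> g * V t" using step(4)[of s] V_nonneg Suc by (simp add: mult_right_mono)
    also have "\<dots> \<le> g * (r ^ t * (norm (x 0))\<^sup>2)"
      using g decay[of t] mult_left_mono[OF V0, of "r ^ t"] r by (intro mult_left_mono) auto
    finally show ?thesis by (simp add: mult.assoc)
  qed
  then have "sqrt ((norm (x t))\<^sup>2) \<le> sqrt (g * r ^ t * (norm (x 0))\<^sup>2)"
    by (rule real_sqrt_le_mono)
  then show "norm (x t) \<le> sqrt g * sqrt ((1 - inverse g) ^ t) * norm (x 0)"
    by (simp add: real_sqrt_mult r_def)
qed

theorem theorem2: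
  fixes A :: "real^'n \<Rightarrow> real^'n^'n"
    and B :: "real^'n \<Rightarrow> real^'m^'n"
    and \<gamma>bar :: real
  assumes A_cont: "continuous_on UNIV A"
    and B_cont: "continuous_on UNIV B"
    and gbar_pos: "\<gamma>bar > 0"
    and feasible: "\<And>x Y P L \<gamma> t. closed_loop_trajectory A B \<gamma>bar x Y P L \<gamma> \<Longrightarrow>
                     sdp_at A B \<gamma>bar x P t \<noteq> {}"
  shows "(\<forall>\<epsilon>>0. \<exists>\<delta>>0. \<forall>x Y P L \<gamma>.
            closed_loop_trajectory A B \<gamma>bar x Y P L \<gamma> \<longrightarrow> norm (x 0) < \<delta> \<longrightarrow>
            (\<forall>t. norm (x t) < \<epsilon>)) \<and>
         (\<forall>x Y P L \<gamma>. closed_loop_trajectory A B \<gamma>bar x Y P L \<gamma> \<longrightarrow>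
            x \<longlonglongrightarrow> 0) \<and>
         (\<forall>x Y P L \<gamma>. closed_loop_trajectory A B \<gamma>bar x Y P L \<gamma> \<longrightarrow>
            (\<forall>t. invertible (P t - mat 1)) \<longrightarrow>
            (\<forall>t. norm (x t) \<le> sqrt \<gamma>bar * sqrt ((1 - inverse \<gamma>bar) ^ t) * norm (x 0)))"
proof (intro conjI allI impI)
  fix \<epsilon> :: real assume \<epsilon>: "0 < \<epsilon>"
  show "\<exists>\<delta>>0. \<forall>x Y P L \<gamma>. closed_loop_trajectory A B \<gamma>bar x Y P L \<gamma> \<longrightarrow>
      norm (x 0) < \<delta> \<longrightarrow> (\<forall>t. norm (x t) < \<epsilon>)"
  proof (intro exI[of _ "\<epsilon> / sqrt \<gamma>bar"] conjI allI impI)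
    show "0 < \<epsilon> / sqrt \<gamma>bar" using \<epsilon> gbar_pos by simp
    fix x Y P L \<gamma> t
    assume traj: "closed_loop_trajectory A B \<gamma>bar x Y P L \<gamma>"
      and small: "norm (x 0) < \<epsilon> / sqrt \<gamma>bar"
    have "(1 - inverse \<gamma>bar) ^ t \<le> 1"
      using closed_loop_geometric_bound(1)[OF traj] by (intro power_le_one) (auto simp: inverse_le_1_iff)
    then have "sqrt \<gamma>bar * sqrt ((1 - inverse \<gamma>bar) ^ t) * norm (x 0) \<le> sqrt \<gamma>bar * norm (x 0)"
      using gbar_pos by (intro mult_right_mono mult_left_le) auto
    also have "\<dots> < \<epsilon>" using small gbar_pos by (simp add: field_simps)
    finally show "norm (x t) < \<epsilon>"
      using closed_loop_geometric_bound(2)[OF traj, of t] by linarith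
  qed
next
  fix x Y P L \<gamma>
  assume traj: "closed_loop_trajectory A B \<gamma>bar x Y P L \<gamma>"
  have "(\<lambda>t. (1 - inverse \<gamma>bar) ^ t) \<longlonglongrightarrow> 0"
    using closed_loop_geometric_bound(1)[OF traj]
    by (intro LIMSEQ_realpow_zero) (auto simp: inverse_le_1_iff)
  then have "(\<lambda>t. sqrt \<gamma>bar * sqrt ((1 - inverse \<gamma>bar) ^ t) * norm (x 0))
      \<longlonglongrightarrow> sqrt \<gamma>bar * sqrt 0 * norm (x 0)"
    by (intro tendsto_mult tendsto_const tendsto_real_sqrt)
  then have "(\<lambda>t. sqrt \<gamma>bar * sqrt ((1 - inverse \<gamma>bar) ^ t) * norm (x 0)) \<longlonglongrightarrow> 0"
    by simp
  then show "x \<longlonglongrightarrow> 0"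
    by (rule Lim_null_comparison[rotated]) (simp add: closed_loop_geometric_bound(2)[OF traj])
next
  fix x Y P L \<gamma> t
  assume "closed_loop_trajectory A B \<gamma>bar x Y P L \<gamma>"
  then show "norm (x t) \<le> sqrt \<gamma>bar * sqrt ((1 - inverse \<gamma>bar) ^ t) * norm (x 0)"
    by (rule closed_loop_geometric_bound(2))
qed

end
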